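(* Let $S$ be a confluent fragment of $\lambda_{alg}^{\to}$, viewed as a fragment of $\lambda_{alg}^{=}$. For every term $M\in S$ and every value $V$: if $M\to^{=*}_{a\cup\beta}V$ (algebraic equality restricted to $S$), then there is a value $V'$ with $M\to^{*}_{a\cup\beta}V'$ and $V(\to^{=}_a)^{*}V'$ (algebraic equality restricted to $S$).
   Context: Fix a ring of scalars (elements $\alpha,\beta$). Terms, values and base terms are given by: $M,N,L ::= V \mid (M)~N \mid \alpha.M \mid M+N$ (terms); $U,V,W ::= 0 \mid B \mid \alpha.V \mid V+W$ (values); $B ::= x \mid \lambda x\,M$ (base terms). $M[x:=N]$ is capture-avoiding substitution. Rewrite rules: $(\beta_n)$ $(\lambda x\,M)~N\to M[x:=N]$. $(A)$ $(M+N)~L\to (M)~L+(N)~L$; $(\alpha.M)~N\to\alpha.(M)~N$; $(0)~M\to 0$. (Asso) $M+(N+L)\to(M+N)+L$ and $(M+N)+L\to M+(N+L)$. (Com) $M+N\to N+M$. $(F)$ $\alpha.M+\beta.M\to(\alpha+\beta).M$; $\alpha.M+M\to(\alpha+1).M$; $M+M\to(1+1).M$; $\alpha.(\beta.M)\to(\alpha\beta).M$. $(S)$ $\alpha.(M+N)\to\alpha.M+\alpha.N$; $1.M\to M$; $0.M\to 0$; $\alpha.0\to 0$; $0+M\to M$. Context rules $(\xi)$: from $M\to M'$ infer $(M)~N\to(M')~N$, $M+N\to M'+N$, $N+M\to N+M'$, $\alpha.M\to\alpha.M'$. Let $L=\mathrm{Asso}\cup\mathrm{Com}\cup F\cup S$.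 $\to_a$ is generated by $A\cup L$ closed under $\xi$; $\to_{\beta_n}$ is generated by $\beta_n$ closed under $\xi$; $\to_{a\cup\beta}:=\to_a\cup\to_{\beta_n}$ (language $\lambda_{alg}^{\to}$). $R^{*}$ is reflexive-transitive closure. A fragment of $\lambda_{alg}^{\to}$ is a set $S$ of terms closed under $\to_{a\cup\beta}$, with the relation restricted to $S$; it is confluent if $\to_{a\cup\beta}$ restricted to $S$ is confluent. As a fragment of $\lambda_{alg}^{=}$, $S$ carries the restricted algebraic equality: $M\to^{=}_a N$ iff $M,N\in S$ and ($M\to_a N$ or $N\to_a M$); and $\to^{=}_{a\cup\beta}$ is this relation union $\to_{\beta_n}$. *)

theory Defs
  imports Main "HOL-Library.Confluence"
begin

text \<open>
  Terms modulo \<open>\<alpha>\<close>-equivalence, represented with de Bruijn indices; free variables are the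
  dangling indices. Associativity and commutativity of \<open>+\<close> are not built into the syntax:
  they are rewrite rules.
\<close>

datatype 'k trm =
    Zero
  | Var nat
  | Lam "'k trm"
  | App "'k trm" "'k trm"
  | Scal 'k "'k trm"
  | Plus "'k trm" "'k trm"

inductive base_term :: "'k trm \<Rightarrow> bool" where
  "base_term (Var i)"
| "base_term (Lam M)"

inductive val :: "'k trm \<Rightarrow> bool" where
  "val Zero"
| "base_term B \<Longrightarrow> val B"
| "val V \<Longrightarrow> val (Scal \<alpha> V)"
| "val V \<Longrightarrow> val W \<Longrightarrow> val (Plus V W)"

text \<open>\<open>lift M k\<close> increments the indices \<open>\<ge> k\<close> of \<open>M\<close>.\<close>

primrec lift :: "'k trm \<Rightarrow> nat \<Rightarrow> 'k trm" where
  "lift Zero k = Zero"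
| "lift (Var i) k = (if i < k then Var i else Var (Suc i))"
| "lift (Lam M) k = Lam (lift M (Suc k))"
| "lift (App M N) k = App (lift M k) (lift N k)"
| "lift (Scal \<alpha> M) k = Scal \<alpha> (lift M k)"
| "lift (Plus M N) k = Plus (lift M k) (lift N k)"

text \<open>
  \<open>subst M N k\<close> replaces index \<open>k\<close> by \<open>N\<close> in \<open>M\<close> and decrements the indices \<open>> k\<close>, since the
  binder of \<open>k\<close> disappears in the \<open>\<beta>\<close>-step.
\<close>

primrec subst :: "'k trm \<Rightarrow> 'k trm \<Rightarrow> nat \<Rightarrow> 'k trm" where
  "subst Zero N k = Zero"
| "subst (Var i) N k = (if k < i then Var (i - 1) else if i = k then N else Var i)"
| "subst (Lam M) N k = Lam (subst M (lift N 0) (Suc k))"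
| "subst (App M L) N k = App (subst M N k) (subst L N k)"
| "subst (Scal \<alpha> M) N k = Scal \<alpha> (subst M N k)"
| "subst (Plus M L) N k = Plus (subst M N k) (subst L N k)"

inductive beta_n :: "'k trm \<Rightarrow> 'k trm \<Rightarrow> bool" where
  "beta_n (App (Lam M) N) (subst M N 0)"

inductive rule_A :: "'k trm \<Rightarrow> 'k trm \<Rightarrow> bool" where
  "rule_A (App (Plus M N) L) (Plus (App M L) (App N L))"
| "rule_A (App (Scal \<alpha> M) N) (Scal \<alpha> (App M N))"
| "rule_A (App Zero M) Zero"

inductive rule_Asso :: "'k trm \<Rightarrow> 'k trm \<Rightarrow> bool" where
  "rule_Asso (Plus M (Plus N L)) (Plus (Plus M N) L)"
| "rule_Asso (Plus (Plus M N) L) (Plus M (Plus N L))"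

inductive rule_Com :: "'k trm \<Rightarrow> 'k trm \<Rightarrow> bool" where
  "rule_Com (Plus M N) (Plus N M)"

text \<open>
  Scalars form a unital ring. The sort \<open>{ring, monoid_mult}\<close> is used instead of \<open>ring_1\<close> because
  the latter excludes the zero ring.
\<close>

inductive rule_F :: "'k::{ring,monoid_mult} trm \<Rightarrow> 'k trm \<Rightarrow> bool" where
  "rule_F (Plus (Scal \<alpha> M) (Scal \<beta> M)) (Scal (\<alpha> + \<beta>) M)"
| "rule_F (Plus (Scal \<alpha> M) M) (Scal (\<alpha> + 1) M)"
| "rule_F (Plus M M) (Scal (1 + 1) M)"
| "rule_F (Scal \<alpha> (Scal \<beta> M)) (Scal (\<alpha> * \<beta>) M)"

inductive rule_S :: "'k::{ring,monoid_mult} trm \<Rightarrow> 'k trm \<Rightarrow> bool" where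
  "rule_S (Scal \<alpha> (Plus M N)) (Plus (Scal \<alpha> M) (Scal \<alpha> N))"
| "rule_S (Scal 1 M) M"
| "rule_S (Scal 0 M) Zero"
| "rule_S (Scal \<alpha> Zero) Zero"
| "rule_S (Plus Zero M) M"

definition rule_L :: "'k::{ring,monoid_mult} trm \<Rightarrow> 'k trm \<Rightarrow> bool" where
  "rule_L = sup (sup rule_Asso rule_Com) (sup rule_F rule_S)"

text \<open>
  Closure under the context rules \<open>\<xi>\<close>: no reduction under \<open>\<lambda>\<close> nor in argument position.
\<close>

inductive xi :: "('k trm \<Rightarrow> 'k trm \<Rightarrow> bool) \<Rightarrow> 'k trm \<Rightarrow> 'k trm \<Rightarrow> bool"
  for R :: "'k trm \<Rightarrow> 'k trm \<Rightarrow> bool" where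
  "R M M' \<Longrightarrow> xi R M M'"
| "xi R M M' \<Longrightarrow> xi R (App M N) (App M' N)"
| "xi R M M' \<Longrightarrow> xi R (Plus M N) (Plus M' N)"
| "xi R M M' \<Longrightarrow> xi R (Plus N M) (Plus N M')"
| "xi R M M' \<Longrightarrow> xi R (Scal \<alpha> M) (Scal \<alpha> M')"

definition red_a :: "'k::{ring,monoid_mult} trm \<Rightarrow> 'k trm \<Rightarrow> bool" where
  "red_a = xi (sup rule_A rule_L)"

definition red_beta :: "'k trm \<Rightarrow> 'k trm \<Rightarrow> bool" where
  "red_beta = xi beta_n"

definition red_ab :: "'k::{ring,monoid_mult} trm \<Rightarrow> 'k trm \<Rightarrow> bool" where
  "red_ab = sup red_a red_beta"

definition restrict_rel :: "'a set \<Rightarrow> ('a \<Rightarrow> 'a \<Rightarrow> bool) \<Rightarrow> 'a \<Rightarrow> 'a \<Rightarrow> bool" where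
  "restrict_rel S R M N \<longleftrightarrow> M \<in> S \<and> N \<in> S \<and> R M N"

definition fragment :: "'k::{ring,monoid_mult} trm set \<Rightarrow> bool" where
  "fragment S \<longleftrightarrow> (\<forall>M\<in>S. \<forall>N. red_ab M N \<longrightarrow> N \<in> S)"

text \<open>
  Terms outside \<open>S\<close> are isolated under the restricted relation, so confluence on the whole type
  amounts to confluence on \<open>S\<close>.
\<close>

definition confluent_fragment :: "'k::{ring,monoid_mult} trm set \<Rightarrow> bool" where
  "confluent_fragment S \<longleftrightarrow> fragment S \<and> confluentp (restrict_rel S red_ab)"

definition eq_a :: "'k::{ring,monoid_mult} trm set \<Rightarrow> 'k trm \<Rightarrow> 'k trm \<Rightarrow> bool" where
  "eq_a S M N \<longleftrightarrow> M \<in> S \<and> N \<in> S \<and> (red_a M N \<or> red_a N M)"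

text \<open>
  The \<open>\<beta>\<close>-part needs no explicit restriction: a fragment is closed under \<open>red_beta\<close>, so no
  sequence of steps starting in \<open>S\<close> leaves it.
\<close>

definition eq_ab :: "'k::{ring,monoid_mult} trm set \<Rightarrow> 'k trm \<Rightarrow> 'k trm \<Rightarrow> bool" where
  "eq_ab S = sup (eq_a S) red_beta"

end

theory Submission
  imports Defs
begin

text \<open>
  By confluence, two convertible terms \<open>M\<close> and \<open>V\<close> have a common reduct \<open>V'\<close>. Since contexts
  reach neither under \<open>\<lambda>\<close> nor into arguments, the only redexes of a value are \<open>L\<close>-redexes, and
  contracting one yields a value again. So if \<open>V\<close> is a value, then \<open>V'\<close> is a value too, and the
  reduction from \<open>V\<close> to \<open>V'\<close> is purely algebraic.
\<close>

lemma val_simps [simp]: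
  "val Zero" "val (Var i)" "val (Lam M)" "\<not> val (App M N)"
  "val (Scal \<alpha> M) \<longleftrightarrow> val M" "val (Plus M N) \<longleftrightarrow> val M \<and> val N"
  by (subst val.simps, force simp: base_term.simps)+

lemma val_not_red_beta: "red_beta V W \<Longrightarrow> \<not> val V"
  unfolding red_beta_def by (induction rule: xi.induct) (auto simp: beta_n.simps)

text \<open>\<open>rule_A\<close> rewrites only applications, which are never values;
  \<open>rule_L\<close> builds its right-hand sides from subterms of the left by
  \<open>Zero\<close>, \<open>Scal\<close> and \<open>Plus\<close>.\<close>

lemma val_red_a:
  assumes "red_a V W" and "val V"
  shows "val W"
  using assms unfolding red_a_def
proof (induction rule: xi.induct)
  case (1 M M')
  then show ?case
    by (auto simp: rule_A.simps rule_L_def rule_Asso.simps rule_Com.simps rule_F.simps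
        rule_S.simps)
qed auto

lemma val_restrict_red_ab:
  assumes "(restrict_rel S red_ab)\<^sup>*\<^sup>* V W" and "val V"
  shows "val W \<and> (eq_a S)\<^sup>*\<^sup>* V W"
  using assms
proof (induction rule: rtranclp_induct)
  case (step U W)
  then have "val U"
    by simp
  then have "red_a U W" and "eq_a S U W"
    using step.hyps(2)
    by (auto simp: restrict_rel_def red_ab_def eq_a_def dest: val_not_red_beta)
  then show ?case
    using step \<open>val U\<close> val_red_a by (metis rtranclp.rtrancl_into_rtrancl)
qed simp

lemma eq_ab_imp_equivclp:
  assumes "fragment S" and "M \<in> S" and "(eq_ab S)\<^sup>*\<^sup>* M N"
  shows "N \<in> S \<and> equivclp (restrict_rel S red_ab) M N"
  using assms(3)
proof (induction rule: rtranclp_induct)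
  case (step U W)
  \<comment> \<open>\<open>eq_ab\<close> uses \<beta>-steps only forwards, so closure of the
    fragment keeps their targets in \<open>S\<close>.\<close>
  have "red_beta U W \<Longrightarrow> W \<in> S"
    using \<open>fragment S\<close> step.IH unfolding fragment_def red_ab_def by blast
  then have "W \<in> S" and "restrict_rel S red_ab U W \<or> restrict_rel S red_ab W U"
    using step.hyps(2) step.IH
    by (auto simp: eq_ab_def eq_a_def restrict_rel_def red_ab_def)
  then show ?case
    using step.IH equivclp_into_equivclp by metis
qed (simp add: assms(2))

theorem theorem5:
  fixes S :: "'k::{ring,monoid_mult} trm set" and M V :: "'k trm"
  assumes "confluent_fragment S"
    and "M \<in> S" and "val V"
    and "(eq_ab S)\<^sup>*\<^sup>* M V"
  shows "\<exists>V'. val V' \<and> red_ab\<^sup>*\<^sup>* M V' \<and> (eq_a S)\<^sup>*\<^sup>* V V'"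
proof -
  let ?R = "restrict_rel S red_ab"
  have "fragment S" and "confluentp ?R"
    using assms(1) by (auto simp: confluent_fragment_def)
  have "equivclp ?R M V"
    using eq_ab_imp_equivclp[OF \<open>fragment S\<close> assms(2,4)] by simp
  \<comment> \<open>Church-Rosser property: the conversion becomes a reduction from \<open>M\<close>
    followed by a reversed reduction from \<open>V\<close>.\<close>
  then obtain V' where "?R\<^sup>*\<^sup>* M V'" and "?R\<^sup>*\<^sup>* V V'"
    using semiconfluentp_equivclp[OF confluentp_imp_semiconfluentp[OF \<open>confluentp ?R\<close>]]
    by (auto simp: rtranclp_conversep)
  moreover have "?R \<le> red_ab"
    by (auto simp: restrict_rel_def)
  ultimately show ?thesis
    using val_restrict_red_ab assms(3) by (metis predicate2D rtranclp_mono)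
qed

end
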